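(* Let $p$ be a prime, $n\ge1$ an integer, $q=p^n$, and let $F,G:\mathbb{F}_q\to\mathbb{F}_q$ be CCZ-equivalent through an affine permutation $\mathcal{A}$ of $\mathbb{F}_q\times\mathbb{F}_q$ mapping the graph of $F$ onto the graph of $G$, with linear part $$M(x,y)=\bigl(M_{11}(x)+M_{12}(y),\,M_{21}(x)+M_{22}(y)\bigr),$$ where each $M_{ij}:\mathbb{F}_q\to\mathbb{F}_q$ is $\mathbb{F}_p$-linear. For $u,b\in\mathbb{F}_q$ define $$\gamma(u,b)=M_{11}(u)+M_{12}(b),\qquad\delta(u,b)=M_{21}(u)+M_{22}(b).$$ Then, for all $u,b\in\mathbb{F}_q$, $$\mathrm{DDT}_F(u,b)=\mathrm{DDT}_G\bigl(\gamma(u,b),\delta(u,b)\bigr).$$ Consequently, for all $u,v\in\mathbb{F}_q$ and $j\in\mathbb{F}_p$, $$N_F(u,v;j)=\sum_{\substack{c\in\mathbb{F}_q\\ \mathrm{Tr}_1^n(vc)=j}}\mathrm{DDT}_G\bigl(\gamma(u,c),\delta(u,c)\bigr)$$ and $$L_F(u,v;j)=\sum_{\substack{c\in\mathbb{F}_q\\ \mathrm{Tr}_1^n(vc)=j}}\mathrm{DDT}_G\bigl(\gamma(u,c),\delta(u,c)\bigr)-p^{n-1}.$$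
   Context: $\mathrm{Tr}_1^n$ is the absolute trace $\mathbb{F}_{p^n}\to\mathbb{F}_p$. Affine and linear are over $\mathbb{F}_p$. $F,G:\mathbb{F}_q\to\mathbb{F}_q$ are CCZ-equivalent if there is an affine permutation $\mathcal{A}$ of $\mathbb{F}_q\times\mathbb{F}_q$ (i.e. $\mathcal{A}(x,y)=M(x,y)+(c_0,d_0)$ with $M$ invertible $\mathbb{F}_p$-linear) that maps the graph $\{(x,F(x)):x\in\mathbb{F}_q\}$ onto the graph $\{(x,G(x)):x\in\mathbb{F}_q\}$. The derivative is $D_uF(x)=F(x+u)-F(x)$, and $\mathrm{DDT}_F(u,b)=\#\{x\in\mathbb{F}_q:D_uF(x)=b\}$. The level count is $N_F(u,v;j)=\#\{x\in\mathbb{F}_q:\mathrm{Tr}_1^n(vD_uF(x))=j\}$ and $L_F(u,v;j)=N_F(u,v;j)-p^{n-1}$. *)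

theory Defs
  imports Complex_Main "HOL-Computational_Algebra.Primes" "HOL-Library.Cardinality" "HOL-Library.Product_Plus"
begin

text \<open>
  The field with \<open>q = p ^ n\<close> elements is a type of class \<^class>\<open>finite_field\<close> with \<open>CARD('a) = p ^ n\<close>.
  Its prime subfield, i.e. the image of the integers in it, plays the role of the field with
  \<open>p\<close> elements, so that traces are elements of \<open>'a\<close>.
\<close>

definition prime_subfield :: "'a::field set" where
  "prime_subfield = range of_int"

definition trace :: "nat \<Rightarrow> nat \<Rightarrow> 'a::field \<Rightarrow> 'a" where
  "trace p n x = (\<Sum>i<n. x ^ (p ^ i))"

definition prod_scale :: "'a::field \<Rightarrow> 'a \<times> 'a \<Rightarrow> 'a \<times> 'a" where
  "prod_scale c z = (c * fst z, c * snd z)"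

text \<open>
  Linearity over the prime subfield, with explicit scalar multiplications \<open>s\<^sub>1\<close> and \<open>s\<^sub>2\<close> on
  domain and codomain. The library predicate for linear maps takes its scalars from a field
  type, which the prime subfield is not.
\<close>

definition linear_over_prime ::
  "('a::field \<Rightarrow> 'b::plus \<Rightarrow> 'b) \<Rightarrow> ('a \<Rightarrow> 'c::plus \<Rightarrow> 'c) \<Rightarrow> ('b \<Rightarrow> 'c) \<Rightarrow> bool" where
  "linear_over_prime s\<^sub>1 s\<^sub>2 f \<longleftrightarrow>
     (\<forall>x y. f (x + y) = f x + f y) \<and>
     (\<forall>c\<in>prime_subfield. \<forall>x. f (s\<^sub>1 c x) = s\<^sub>2 c (f x))"

abbreviation fp_linear :: "('a::field \<Rightarrow> 'a) \<Rightarrow> bool" where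
  "fp_linear \<equiv> linear_over_prime (*) (*)"

abbreviation fp_linear_prod :: "('a::field \<times> 'a \<Rightarrow> 'a \<times> 'a) \<Rightarrow> bool" where
  "fp_linear_prod \<equiv> linear_over_prime prod_scale prod_scale"

definition affine_with_linear_part ::
  "('a::field \<times> 'a \<Rightarrow> 'a \<times> 'a) \<Rightarrow> ('a \<times> 'a \<Rightarrow> 'a \<times> 'a) \<Rightarrow> bool" where
  "affine_with_linear_part A M \<longleftrightarrow>
     fp_linear_prod M \<and> (\<exists>c\<^sub>0 d\<^sub>0. \<forall>z. A z = M z + (c\<^sub>0, d\<^sub>0))"

definition affine_permutation :: "('a::field \<times> 'a \<Rightarrow> 'a \<times> 'a) \<Rightarrow> bool" where
  "affine_permutation A \<longleftrightarrow> (\<exists>M. affine_with_linear_part A M \<and> bij M)"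

definition graph_of :: "('a \<Rightarrow> 'a) \<Rightarrow> ('a \<times> 'a) set" where
  "graph_of F = {(x, F x) | x. True}"

definition ccz_equivalent_via ::
  "('a::field \<times> 'a \<Rightarrow> 'a \<times> 'a) \<Rightarrow> ('a \<Rightarrow> 'a) \<Rightarrow> ('a \<Rightarrow> 'a) \<Rightarrow> bool" where
  "ccz_equivalent_via A F G \<longleftrightarrow> affine_permutation A \<and> A ` graph_of F = graph_of G"

definition derivative :: "('a::field \<Rightarrow> 'a) \<Rightarrow> 'a \<Rightarrow> 'a \<Rightarrow> 'a" where
  "derivative F u x = F (x + u) - F x"

definition DDT :: "('a::finite_field \<Rightarrow> 'a) \<Rightarrow> 'a \<Rightarrow> 'a \<Rightarrow> nat" where
  "DDT F u b = card {x. derivative F u x = b}"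

definition level_count ::
  "nat \<Rightarrow> nat \<Rightarrow> ('a::finite_field \<Rightarrow> 'a) \<Rightarrow> 'a \<Rightarrow> 'a \<Rightarrow> 'a \<Rightarrow> nat" where
  "level_count p n F u v j = card {x. trace p n (v * derivative F u x) = j}"

definition level_deviation ::
  "nat \<Rightarrow> nat \<Rightarrow> ('a::finite_field \<Rightarrow> 'a) \<Rightarrow> 'a \<Rightarrow> 'a \<Rightarrow> 'a \<Rightarrow> int" where
  "level_deviation p n F u v j = int (level_count p n F u v j) - int (p ^ (n - 1))"

end

theory Submission
  imports Defs
begin

text \<open>
  The map \<open>x \<mapsto> (x, F x)\<close> identifies the solutions of \<open>F (x + u) - F x = b\<close> with the points \<open>z\<close> of
  the graph of \<open>F\<close> for which \<open>z + (u, b)\<close> lies on the graph too. An affine permutation \<open>A\<close> with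
  linear part \<open>M\<close> satisfies \<open>A (z + w) = A z + M w\<close>, so it carries the pairs of graph points with
  difference \<open>w\<close> bijectively to those with difference \<open>M w\<close>. The level counts are then obtained by
  sorting the points \<open>x\<close> by the value of the derivative.
\<close>

text \<open>Puts the count in terms of graph points, on which \<open>A\<close> acts; it does not act
  on the arguments \<open>x\<close>.\<close>

lemma DDT_eq_card_graph:
  "DDT F u b = card {z \<in> graph_of F. z + (u, b) \<in> graph_of F}"
proof -
  have "{z \<in> graph_of F. z + (u, b) \<in> graph_of F} = (\<lambda>x. (x, F x)) ` {x. derivative F u x = b}"
    by (auto simp: graph_of_def derivative_def algebra_simps)
  moreover have "inj_on (\<lambda>x. (x, F x)) {x. derivative F u x = b}"
    by (simp add: inj_on_def)
  ultimately show ?thesis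
    by (simp add: DDT_def card_image)
qed

lemma affine_with_linear_part_add:
  assumes "affine_with_linear_part A M"
  shows "A (z + w) = A z + M w"
proof -
  obtain c d where "\<And>z. A z = M z + (c, d)"
    using assms unfolding affine_with_linear_part_def by blast
  moreover have "M (z + w) = M z + M w"
    using assms unfolding affine_with_linear_part_def linear_over_prime_def by blast
  ultimately show ?thesis
    by (simp only: add.assoc add.commute add.left_commute)
qed

lemma affine_permutation_inj:
  assumes "affine_permutation A"
  shows "inj A"
proof -
  obtain M c d where "bij M" and "\<And>z. A z = M z + (c, d)"
    using assms unfolding affine_permutation_def affine_with_linear_part_def by blast
  then show ?thesis
    by (simp add: inj_def bij_def)
qed

text \<open>\<open>M\<close> stays abstract here; its blocks enter only through the value
  \<open>(u', b')\<close> at \<open>(u, b)\<close>.\<close>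

lemma DDT_ccz_equivalent:
  assumes ccz: "ccz_equivalent_via A F G"
    and aff: "affine_with_linear_part A M"
    and M: "M (u, b) = (u', b')"
  shows "DDT F u b = DDT G u' b'"
proof -
  have inj: "inj A" and img: "A ` graph_of F = graph_of G"
    using ccz affine_permutation_inj unfolding ccz_equivalent_via_def by blast+
  \<comment> \<open>Injectivity keeps points off the graph of \<open>F\<close> off the graph of
    \<open>G\<close>. This matters for \<open>z + (u, b)\<close>, which need not be a graph
    point.\<close>
  have mem: "A z \<in> graph_of G \<longleftrightarrow> z \<in> graph_of F" for z
    using inj by (simp flip: img add: inj_image_mem_iff)
  have shift: "A z + (u', b') = A (z + (u, b))" for z
    by (simp only: affine_with_linear_part_add[OF aff] M)
  have "{z \<in> graph_of G. z + (u', b') \<in> graph_of G}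
      = A ` {z \<in> graph_of F. z + (u, b) \<in> graph_of F}" (is "?R = A ` ?L")
  proof
    show "?R \<subseteq> A ` ?L"
    proof
      fix y assume y: "y \<in> ?R"
      then obtain z where "z \<in> graph_of F" "y = A z"
        using img by blast
      with y show "y \<in> A ` ?L"
        by (simp only: mem_Collect_eq shift mem) blast
    qed
    show "A ` ?L \<subseteq> ?R"
      using mem shift by auto
  qed
  moreover have "card (A ` ?L) = card ?L"
    using inj by (intro card_image) (auto intro: inj_on_subset)
  ultimately show ?thesis
    by (simp only: DDT_eq_card_graph)
qed

text \<open>The fibres of the derivative over distinct values \<open>c\<close> are disjoint. Only
  \<open>F\<close> occurs; \<open>G\<close> enters when each summand is rewritten.\<close>

lemma level_count_eq_sum_DDT:
  "level_count p n F u v j = (\<Sum>c | trace p n (v * c) = j. DDT F u c)"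
proof -
  have "{x. trace p n (v * derivative F u x) = j}
      = (\<Union>c\<in>{c. trace p n (v * c) = j}. {x. derivative F u x = c})"
    by auto
  moreover have "card \<dots> = (\<Sum>c | trace p n (v * c) = j. card {x. derivative F u x = c})"
    by (intro card_UN_disjoint) auto
  ultimately show ?thesis
    by (simp only: level_count_def DDT_def)
qed

theorem theorem5p5:
  fixes p n :: nat
    and F G :: "'a::finite_field \<Rightarrow> 'a"
    and A :: "'a \<times> 'a \<Rightarrow> 'a \<times> 'a"
    and M11 M12 M21 M22 :: "'a \<Rightarrow> 'a"
    and \<gamma> \<delta> :: "'a \<Rightarrow> 'a \<Rightarrow> 'a"
  assumes "prime p" and "n \<ge> 1" and "CARD('a) = p ^ n"
    and "ccz_equivalent_via A F G"
    and "fp_linear M11" and "fp_linear M12" and "fp_linear M21" and "fp_linear M22"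
    and "affine_with_linear_part A (\<lambda>(x, y). (M11 x + M12 y, M21 x + M22 y))"
    and "\<And>u b. \<gamma> u b = M11 u + M12 b"
    and "\<And>u b. \<delta> u b = M21 u + M22 b"
  shows "(\<forall>u b. DDT F u b = DDT G (\<gamma> u b) (\<delta> u b)) \<and>
    (\<forall>u v. \<forall>j\<in>prime_subfield.
       level_count p n F u v j
         = (\<Sum>c | trace p n (v * c) = j. DDT G (\<gamma> u c) (\<delta> u c)) \<and>
       level_deviation p n F u v j
         = int (\<Sum>c | trace p n (v * c) = j. DDT G (\<gamma> u c) (\<delta> u c)) - int (p ^ (n - 1)))"
proof -
  have "DDT F u b = DDT G (\<gamma> u b) (\<delta> u b)" for u b
    using assms(4,9) by (rule DDT_ccz_equivalent) (simp add: assms(10,11))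
  then show ?thesis
    by (simp add: level_count_eq_sum_DDT level_deviation_def)
qed

end
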